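(* Let $(X,R)$ and $(X',R')$ be objects of $\mathrm{Endo}(\mathrm{FRel})$ in canonical form. Then $(X,R)$ and $(X',R')$ are isomorphic in $\mathrm{Szym}(\mathrm{FRel})$ if and only if they are isomorphic in $\mathrm{Endo}(\mathrm{FRel})$.
   Context: $\mathbb N=\{0,1,2,\dots\}$, $\mathbb N_1=\{1,2,\dots\}$. For relations $R\subset X\times Y$, $S\subset Y\times Z$ the composition is $S\circ R=\{(x,z): \exists y\in Y,\ (x,y)\in R,\ (y,z)\in S\}$; for $R\subset X\times X$, $R^0=\mathrm{id}_X$ and $R^n=R\circ R^{n-1}$; for $A\subset X$, $R|_A=R\cap(A\times A)$. Categories. $\mathrm{FRel}$: objects are finite sets, morphisms $X\to X'$ are all relations in $X\times X'$, and the composition of morphisms $R\subset X\times X'$ and $R'\subset X'\times X''$ is the composition of relations $R'\circ R=\{(x,x''): \exists x'\in X',\ (x,x')\in R,\ (x',x'')\in R'\}$. $\mathrm{Endo}(\mathrm{FRel})$: objects are pairs $(X,R)$ with $X$ a finite set and $R\subset X\times X$; morphisms $(X,R)\to(X',R')$ are relations $S\subset X\times X'$ with $S\circ R=R'\circ S$. $\mathrm{Szym}(\mathrm{FRel})$: same objects as $\mathrm{Endo}(\mathrm{FRel})$; morphisms $(X,R)\to(X',R')$ are equivalence classes $[S,m]$ of pairs $(S,m)$, with $S:(X,R)\to(X',R')$ a morphism in $\mathrm{Endo}(\mathrm{FRel})$ and $m\in\mathbb N$, where $(S,m)\equiv(S',m')$ iff there is $k\in\mathbb N$ with $S\circ R^{m'+k}=S'\circ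 R^{m+k}$; composition is $[S',m']\circ[S,m]=[S'\circ S,m+m']$ and the identity of $(X,R)$ is $[\mathrm{id}_X,0]$. Recurrence. For $R\subset X\times X$, write $x\leftrightarrow_R y$ if $(x,y)\in R^n$ and $(y,x)\in R^m$ for some $n,m\in\mathbb N_1$. The recurrent set is $X_R=\{x\in X: x\leftrightarrow_R x\}$; $\leftrightarrow_R$ is an equivalence relation on $X_R$ whose classes $[x]_R$ are called the strongly connected components of $R$. An eventual period of $R$ is any $p\in\mathbb N_1$ such that $R^{i+p}=R^i$ for all $i\ge p$ (it always exists for finite $X$). Canonical form. $(X,R)$ is in canonical form (is canonical) if: (i) $X=X_R$; (ii) for each $x\in X$ the restriction $R|_{[x]_R}$ is a bijective map $[x]_R\to[x]_R$; (iii) $R^{n+p}=R^n$ for each $n\in\mathbb N_1$, where $p$ is an eventual period of $R$. *)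

theory Defs
  imports Main
begin

text \<open>Isabelle's relational composition is diagrammatic; this abbreviation is the categorical order.\<close>

abbreviation (input) rel_after :: "('b \<times> 'c) set \<Rightarrow> ('a \<times> 'b) set \<Rightarrow> ('a \<times> 'c) set"  (infixr "\<circ>\<^sub>r" 75)
  where "S \<circ>\<^sub>r R \<equiv> R O S"

text \<open>The library power has \<open>R ^^ 0 = Id\<close> on the whole type; here the zeroth power is the
  identity of \<open>X\<close>. The positive powers agree with the library ones when \<open>R \<subseteq> X \<times> X\<close>
  (lemma \<open>rpow_Suc_eq_relpow\<close>).\<close>

primrec rpow :: "'a set \<Rightarrow> 'a rel \<Rightarrow> nat \<Rightarrow> 'a rel" where
  "rpow X R 0 = Id_on X"
| "rpow X R (Suc n) = R \<circ>\<^sub>r rpow X R n"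

lemma rpow_Suc_eq_relpow:
  assumes "R \<subseteq> X \<times> X"
  shows "rpow X R (Suc n) = R ^^ Suc n"
proof (induction n)
  case 0
  show ?case using assms by auto
next
  case (Suc n)
  then show ?case by (metis relpow.simps(2) rpow.simps(2))
qed

type_synonym 'a robj = "'a set \<times> 'a rel"

definition endo_obj :: "'a robj \<Rightarrow> bool" where
  "endo_obj A \<longleftrightarrow> finite (fst A) \<and> snd A \<subseteq> fst A \<times> fst A"

definition endo_hom :: "'a robj \<Rightarrow> 'b robj \<Rightarrow> ('a \<times> 'b) set set" where
  "endo_hom A B = {S. S \<subseteq> fst A \<times> fst B \<and> S \<circ>\<^sub>r snd A = snd B \<circ>\<^sub>r S}"

definition endo_isomorphic :: "'a robj \<Rightarrow> 'b robj \<Rightarrow> bool" where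
  "endo_isomorphic A B \<longleftrightarrow>
     (\<exists>S \<in> endo_hom A B. \<exists>T \<in> endo_hom B A.
        T \<circ>\<^sub>r S = Id_on (fst A) \<and> S \<circ>\<^sub>r T = Id_on (fst B))"

definition szym_equiv ::
  "'a robj \<Rightarrow> 'b robj \<Rightarrow> ((('a \<times> 'b) set \<times> nat) \<times> (('a \<times> 'b) set \<times> nat)) set" where
  "szym_equiv A B =
     {((S, m), (S', m')). S \<in> endo_hom A B \<and> S' \<in> endo_hom A B \<and>
        (\<exists>k. S \<circ>\<^sub>r rpow (fst A) (snd A) (m' + k) = S' \<circ>\<^sub>r rpow (fst A) (snd A) (m + k))}"

definition szym_class ::
  "'a robj \<Rightarrow> 'b robj \<Rightarrow> ('a \<times> 'b) set \<Rightarrow> nat \<Rightarrow> (('a \<times> 'b) set \<times> nat) set" where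
  "szym_class A B S m = szym_equiv A B `` {(S, m)}"

definition szym_hom :: "'a robj \<Rightarrow> 'b robj \<Rightarrow> (('a \<times> 'b) set \<times> nat) set set" where
  "szym_hom A B = (endo_hom A B \<times> UNIV) // szym_equiv A B"

text \<open>Composition of classes \<open>g\<close> after \<open>f\<close>, for \<open>f\<close> with source \<open>A\<close> and \<open>g\<close> with target \<open>C\<close>,
  as the union over representatives; independence of representatives is \<open>szym_comp_class\<close>.\<close>

definition szym_comp ::
  "'a robj \<Rightarrow> 'c robj \<Rightarrow> (('b \<times> 'c) set \<times> nat) set \<Rightarrow> (('a \<times> 'b) set \<times> nat) set
     \<Rightarrow> (('a \<times> 'c) set \<times> nat) set" where
  "szym_comp A C g f = (\<Union>(S, m) \<in> f. \<Union>(S', m') \<in> g. szym_class A C (S' \<circ>\<^sub>r S) (m + m'))"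

definition szym_id :: "'a robj \<Rightarrow> (('a \<times> 'a) set \<times> nat) set" where
  "szym_id A = szym_class A A (Id_on (fst A)) 0"

definition szym_isomorphic :: "'a robj \<Rightarrow> 'b robj \<Rightarrow> bool" where
  "szym_isomorphic A B \<longleftrightarrow>
     (\<exists>f \<in> szym_hom A B. \<exists>g \<in> szym_hom B A.
        szym_comp A A g f = szym_id A \<and> szym_comp B B f g = szym_id B)"

lemma rpow_add:
  assumes "R \<subseteq> X \<times> X"
  shows "rpow X R m O rpow X R n = rpow X R (m + n)"
proof (induction n)
  case 0
  have "rpow X R m \<subseteq> X \<times> X" using assms by (induction m) auto
  then show ?case by auto
next
  case (Suc n)
  then show ?case by (simp add: O_assoc[symmetric])
qed

lemma endo_hom_rpow:
  assumes "S \<in> endo_hom A B"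
  shows "S \<circ>\<^sub>r rpow (fst A) (snd A) n = rpow (fst B) (snd B) n \<circ>\<^sub>r S"
proof (induction n)
  case 0
  show ?case using assms by (auto simp: endo_hom_def)
next
  case (Suc n)
  have e: "snd A O S = S O snd B" using assms by (simp add: endo_hom_def)
  have "rpow (fst A) (snd A) (Suc n) O S = rpow (fst A) (snd A) n O S O snd B"
    by (simp add: O_assoc e)
  also have "\<dots> = (rpow (fst A) (snd A) n O S) O snd B"
    by (rule O_assoc[symmetric])
  also have "\<dots> = S O rpow (fst B) (snd B) (Suc n)"
    by (simp only: Suc O_assoc rpow.simps)
  finally show ?case .
qed

lemma endo_hom_comp:
  assumes "S \<in> endo_hom A B" "T \<in> endo_hom B C"
  shows "T \<circ>\<^sub>r S \<in> endo_hom A C"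
proof -
  have "S O T \<subseteq> fst A \<times> fst C" using assms by (auto simp: endo_hom_def)
  moreover have "snd A O S O T = (S O T) O snd C"
  proof -
    have "snd A O S = S O snd B" "snd B O T = T O snd C"
      using assms by (auto simp: endo_hom_def)
    then show ?thesis by (metis O_assoc)
  qed
  ultimately show ?thesis by (simp add: endo_hom_def)
qed

lemma equiv_szym_equiv:
  assumes "endo_obj A"
  shows "equiv (endo_hom A B \<times> UNIV) (szym_equiv A B)"
proof (rule equivI)
  let ?p = "rpow (fst A) (snd A)"
  show "szym_equiv A B \<subseteq> (endo_hom A B \<times> UNIV) \<times> (endo_hom A B \<times> UNIV)"
    by (auto simp: szym_equiv_def)
  show "refl_on (endo_hom A B \<times> UNIV) (szym_equiv A B)"
    by (auto simp: szym_equiv_def refl_on_def)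
  show "sym (szym_equiv A B)"
  proof (rule symI)
    fix x y assume "(x, y) \<in> szym_equiv A B"
    then show "(y, x) \<in> szym_equiv A B"
      unfolding szym_equiv_def by clarsimp metis
  qed
  have add: "?p m O ?p n = ?p (m + n)" for m n
    using assms rpow_add by (metis endo_obj_def)
  show "trans (szym_equiv A B)"
  proof (rule transI)
    fix x y z assume xy: "(x, y) \<in> szym_equiv A B" and yz: "(y, z) \<in> szym_equiv A B"
    obtain S m T n U q where e: "x = (S, m)" "y = (T, n)" "z = (U, q)"
      by (metis surj_pair)
    obtain k where k: "?p (n + k) O S = ?p (m + k) O T"
      using xy by (auto simp: e szym_equiv_def)
    obtain l where l: "?p (q + l) O T = ?p (n + l) O U"
      using yz by (auto simp: e szym_equiv_def)
    have "?p (q + (n + k + l)) O S = ?p (q + l) O ?p (n + k) O S"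
      by (simp add: O_assoc[symmetric] add add_ac)
    also have "\<dots> = ?p (m + k) O ?p (q + l) O T"
      by (simp only: k) (simp add: O_assoc[symmetric] add add_ac)
    also have "\<dots> = ?p (m + (n + k + l)) O U"
      by (simp only: l) (simp add: O_assoc[symmetric] add add_ac)
    finally show "(x, z) \<in> szym_equiv A B"
      using xy yz by (auto simp: e szym_equiv_def)
  qed
qed

lemma szym_comp_class:
  assumes A: "endo_obj A" and B: "endo_obj B"
    and S: "S \<in> endo_hom A B" and S': "S' \<in> endo_hom B C"
  shows "szym_comp A C (szym_class B C S' m') (szym_class A B S m)
           = szym_class A C (S' \<circ>\<^sub>r S) (m + m')"
proof -
  let ?p = "rpow (fst A) (snd A)" and ?q = "rpow (fst B) (snd B)"
  have addA: "?p i O ?p j = ?p (i + j)" for i j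
    using A rpow_add by (metis endo_obj_def)
  have addB: "?q i O ?q j = ?q (i + j)" for i j
    using B rpow_add by (metis endo_obj_def)
  have cls: "szym_class A C (T' \<circ>\<^sub>r T) (n + n') = szym_class A C (S' \<circ>\<^sub>r S) (m + m')"
    if T: "((S, m), (T, n)) \<in> szym_equiv A B" and T': "((S', m'), (T', n')) \<in> szym_equiv B C"
    for T n T' n'
  proof -
    have hT: "T \<in> endo_hom A B" and hT': "T' \<in> endo_hom B C"
      using T T' by (auto simp: szym_equiv_def)
    obtain k where k: "?p (n + k) O S = ?p (m + k) O T"
      using T by (auto simp: szym_equiv_def)
    obtain l where l: "?q (n' + l) O S' = ?q (m' + l) O T'"
      using T' by (auto simp: szym_equiv_def)
    have "?p (n + n' + (k + l)) O S O S' = ?p (n' + l) O (?p (n + k) O S) O S'"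
      by (simp add: O_assoc[symmetric] addA add_ac)
    also have "\<dots> = ?p (m + k) O (?p (n' + l) O T) O S'"
      by (simp only: k) (simp add: O_assoc[symmetric] addA add_ac)
    also have "\<dots> = ?p (m + k) O T O ?q (n' + l) O S'"
      by (simp only: endo_hom_rpow[OF hT] O_assoc)
    also have "\<dots> = ?p (m + k) O (T O ?q (m' + l)) O T'"
      by (simp only: l O_assoc)
    also have "\<dots> = ?p (m + m' + (k + l)) O T O T'"
      by (simp only: endo_hom_rpow[OF hT, symmetric])
         (simp add: O_assoc[symmetric] addA add_ac)
    finally have "((S O S', m + m'), (T O T', n + n')) \<in> szym_equiv A C"
      using endo_hom_comp[OF S S'] endo_hom_comp[OF hT hT'] by (auto simp: szym_equiv_def)
    then show ?thesis
      unfolding szym_class_def by (metis equiv_class_eq equiv_szym_equiv[OF A])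
  qed
  have "(S, m) \<in> szym_class A B S m" "(S', m') \<in> szym_class B C S' m'"
    using S S' by (auto simp: szym_class_def szym_equiv_def)
  then have ne: "szym_class A B S m \<noteq> {}" "szym_class B C S' m' \<noteq> {}"
    by auto
  have "szym_comp A C (szym_class B C S' m') (szym_class A B S m)
          = (\<Union>f \<in> szym_class A B S m. \<Union>g \<in> szym_class B C S' m'.
               szym_class A C (S' \<circ>\<^sub>r S) (m + m'))"
    unfolding szym_comp_def
  proof (rule SUP_cong[OF refl], clarify, rule SUP_cong[OF refl], clarify)
    fix T n T' n'
    assume "(T, n) \<in> szym_class A B S m" "(T', n') \<in> szym_class B C S' m'"
    then show "szym_class A C (T' \<circ>\<^sub>r T) (n + n') = szym_class A C (S' \<circ>\<^sub>r S) (m + m')"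
      using cls by (simp only: szym_class_def Image_singleton_iff)
  qed
  also have "\<dots> = szym_class A C (S' \<circ>\<^sub>r S) (m + m')"
    using ne by simp
  finally show ?thesis .
qed

definition connected_by :: "'a robj \<Rightarrow> 'a \<Rightarrow> 'a \<Rightarrow> bool" where
  "connected_by A x y \<longleftrightarrow>
     (\<exists>n \<ge> 1. \<exists>m \<ge> 1. (x, y) \<in> rpow (fst A) (snd A) n \<and> (y, x) \<in> rpow (fst A) (snd A) m)"

definition recurrent_set :: "'a robj \<Rightarrow> 'a set" where
  "recurrent_set A = {x \<in> fst A. connected_by A x x}"

definition scc :: "'a robj \<Rightarrow> 'a \<Rightarrow> 'a set" where
  "scc A x = {y \<in> recurrent_set A. connected_by A x y}"

definition eventual_period :: "'a robj \<Rightarrow> nat \<Rightarrow> bool" where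
  "eventual_period A p \<longleftrightarrow>
     p \<ge> 1 \<and> (\<forall>i \<ge> p. rpow (fst A) (snd A) (i + p) = rpow (fst A) (snd A) i)"

definition is_bijective_map :: "('a \<times> 'b) set \<Rightarrow> 'a set \<Rightarrow> 'b set \<Rightarrow> bool" where
  "is_bijective_map F A B \<longleftrightarrow> (\<exists>f. bij_betw f A B \<and> F = {(a, f a) | a. a \<in> A})"

text \<open>The third condition does not depend on which eventual period is taken
  (lemma \<open>period_from_one_indep\<close>).\<close>

definition canonical :: "'a robj \<Rightarrow> bool" where
  "canonical A \<longleftrightarrow>
     fst A = recurrent_set A \<and>
     (\<forall>x \<in> fst A. is_bijective_map (snd A \<inter> (scc A x \<times> scc A x)) (scc A x) (scc A x)) \<and>
     (\<exists>p. eventual_period A p \<and>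
        (\<forall>n \<ge> 1. rpow (fst A) (snd A) (n + p) = rpow (fst A) (snd A) n))"

lemma period_from_one_indep:
  assumes per: "\<forall>n \<ge> 1. rpow (fst A) (snd A) (n + p) = rpow (fst A) (snd A) n"
    and p: "eventual_period A p" and q: "eventual_period A q" and n: "n \<ge> 1"
  shows "rpow (fst A) (snd A) (n + q) = rpow (fst A) (snd A) n"
proof -
  let ?r = "rpow (fst A) (snd A)"
  have it: "?r (i + k * p) = ?r i" if "i \<ge> 1" for i k
  proof (induction k)
    case (Suc k)
    have "?r (i + Suc k * p) = ?r ((i + k * p) + p)" by (simp add: algebra_simps)
    also have "\<dots> = ?r (i + k * p)" using per that by simp
    finally show ?case using Suc by simp
  qed simp
  have "p \<ge> 1" using p by (simp add: eventual_period_def)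
  then have "q * 1 \<le> q * p" by (rule mult_le_mono2)
  then have le: "q \<le> n + q * p" by linarith
  have "?r (n + q) = ?r ((n + q) + q * p)" using it n by simp
  also have "\<dots> = ?r ((n + q * p) + q)" by (simp add: add_ac)
  also have "\<dots> = ?r (n + q * p)" using q le by (simp add: eventual_period_def)
  also have "\<dots> = ?r n" using it n by simp
  finally show ?thesis .
qed

end

theory Submission imports Defs begin

text \<open>
  If \<open>(X, R)\<close> is canonical and \<open>N\<close> is a period of the sequence of positive powers of \<open>R\<close>, then
  \<open>E = R\<^sup>N\<close> is a partial order on \<open>X\<close>: reflexive because every point is recurrent, antisymmetric
  because \<open>R\<close> is single-valued on each strongly connected component. Composing with powers of
  \<open>R\<close> and \<open>R'\<close>, an isomorphism in \<open>Szym(FRel)\<close> is represented by morphisms \<open>S\<close>, \<open>T\<close> with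
  \<open>T \<circ> S = E\<close>, \<open>S \<circ> T = E'\<close> and \<open>S \<circ> E = S = E' \<circ> S\<close>. Reflexivity and antisymmetry make
  \<open>F = S \<inter> T\<inverse>\<close> a bijection with \<open>S = F \<circ> E = E' \<circ> F\<close>. Since \<open>E \<circ> R = R\<close> and
  \<open>R' \<circ> E' = R'\<close>, the equation \<open>S \<circ> R = R' \<circ> S\<close> turns into \<open>F \<circ> R = R' \<circ> F\<close>.
\<close>

section \<open>Powers of a canonical relation\<close>

lemma rpow_periodic_mult:
  assumes "\<forall>n \<ge> 1. rpow X R (n + p) = rpow X R n" and "n \<ge> 1"
  shows "rpow X R (n + k * p) = rpow X R n"
proof (induction k)
  case (Suc k)
  have "rpow X R (n + Suc k * p) = rpow X R ((n + k * p) + p)" by (simp add: algebra_simps)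
  also have "\<dots> = rpow X R (n + k * p)" using assms by simp
  finally show ?case using Suc by simp
qed simp

lemma rpow_trans:
  assumes "R \<subseteq> X \<times> X" "(x, y) \<in> rpow X R m" "(y, z) \<in> rpow X R n"
  shows "(x, z) \<in> rpow X R (m + n)"
  using assms rpow_add[OF assms(1)] by blast

text \<open>A closed walk of length \<open>n\<close> at \<open>x\<close>, run \<open>N\<close>
  times, has length \<open>N * n = N + (n - 1) * N\<close>; periodicity cuts this down to
  \<open>N\<close>.\<close>

lemma canonical_rpow_refl:
  assumes A: "endo_obj (X, R)" and can: "canonical (X, R)"
    and per: "\<forall>n \<ge> 1. rpow X R (n + N) = rpow X R n" and N: "N \<ge> 1"
  shows "Id_on X \<subseteq> rpow X R N"
proof
  fix z assume "z \<in> Id_on X"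
  then obtain x where x: "z = (x, x)" "x \<in> X" by auto
  have R: "R \<subseteq> X \<times> X" using A by (simp add: endo_obj_def)
  have "x \<in> recurrent_set (X, R)" using x can by (simp add: canonical_def)
  then obtain n where n: "n \<ge> 1" "(x, x) \<in> rpow X R n"
    by (auto simp: recurrent_set_def connected_by_def)
  have "(x, x) \<in> rpow X R (k * n)" for k
    using x n rpow_trans[OF R, of x x n x] by (induction k) auto
  then have "(x, x) \<in> rpow X R (N * n)" .
  moreover have "N * n = N + (n - 1) * N" using n by (cases n) auto
  ultimately show "z \<in> rpow X R N" using rpow_periodic_mult[OF per N] x by metis
qed

text \<open>\<open>c\<close> is reached from \<open>x\<close> through \<open>a\<close> and returns
  to \<open>x\<close> through \<open>b\<close>; the outer lengths \<open>i\<close> and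
  \<open>j\<close> are positive even when \<open>m\<close> or \<open>n\<close> is 0.\<close>

lemma scc_between:
  assumes A: "endo_obj (X, R)" and can: "canonical (X, R)"
    and a: "a \<in> scc (X, R) x" and b: "b \<in> scc (X, R) x"
    and ac: "(a, c) \<in> rpow X R m" and cb: "(c, b) \<in> rpow X R n"
  shows "c \<in> scc (X, R) x"
proof -
  have R: "R \<subseteq> X \<times> X" using A by (simp add: endo_obj_def)
  obtain i where i: "i \<ge> 1" "(x, a) \<in> rpow X R i"
    using a by (auto simp: scc_def connected_by_def)
  obtain j where j: "j \<ge> 1" "(b, x) \<in> rpow X R j"
    using b by (auto simp: scc_def connected_by_def)
  have "rpow X R m \<subseteq> X \<times> X" using R by (induction m) auto
  then have "c \<in> recurrent_set (X, R)" using ac can by (auto simp: canonical_def)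
  moreover have "(x, c) \<in> rpow X R (i + m)" "(c, x) \<in> rpow X R (n + j)"
    using rpow_trans[OF R] i j ac cb by blast+
  then have "connected_by (X, R) x c"
    unfolding connected_by_def fst_conv snd_conv using i(1) j(1) by (meson trans_le_add1 trans_le_add2)
  ultimately show ?thesis by (simp add: scc_def)
qed

text \<open>By \<open>scc_between\<close> a walk joining two points of the component stays inside
  it, where every step follows one map \<open>f\<close>. The induction peels off the last
  step.\<close>

lemma canonical_rpow_single_valued_on_scc:
  assumes A: "endo_obj (X, R)" and can: "canonical (X, R)" and x: "x \<in> X"
    and a: "a \<in> scc (X, R) x"
  shows "b \<in> scc (X, R) x \<Longrightarrow> b' \<in> scc (X, R) x \<Longrightarrow>
    (a, b) \<in> rpow X R n \<Longrightarrow> (a, b') \<in> rpow X R n \<Longrightarrow> b = b'"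
proof (induction n arbitrary: b b')
  case 0
  then show ?case by auto
next
  case (Suc n)
  let ?C = "scc (X, R) x"
  have R: "R \<subseteq> X \<times> X" using A by (simp add: endo_obj_def)
  have one: "rpow X R 1 = R" using R by auto
  obtain c where c: "(a, c) \<in> rpow X R n" "(c, b) \<in> R" using Suc.prems by auto
  obtain c' where c': "(a, c') \<in> rpow X R n" "(c', b') \<in> R" using Suc.prems by auto
  have C: "c \<in> ?C" "c' \<in> ?C"
    using scc_between[OF A can a _ _ , where n = 1] Suc.prems c c' one by metis+
  then have "c = c'" using Suc.IH c c' by blast
  moreover obtain f where "R \<inter> (?C \<times> ?C) = {(u, f u) | u. u \<in> ?C}"
    using can x by (auto simp: canonical_def is_bijective_map_def)
  then have "v = f u" if "(u, v) \<in> R" "u \<in> ?C" "v \<in> ?C" for u v using that by blast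
  ultimately show "b = b'" using c c' C Suc.prems by metis
qed

text \<open>By reflexivity \<open>x\<close> is an \<open>N\<close>-step successor of itself;
  \<open>y\<close> is another one in the same component, so single-valuedness identifies
  them.\<close>

lemma canonical_rpow_antisym:
  assumes A: "endo_obj (X, R)" and can: "canonical (X, R)"
    and per: "\<forall>n \<ge> 1. rpow X R (n + N) = rpow X R n" and N: "N \<ge> 1"
  shows "antisym (rpow X R N)"
proof (rule antisymI)
  fix x y assume xy: "(x, y) \<in> rpow X R N" and yx: "(y, x) \<in> rpow X R N"
  have R: "R \<subseteq> X \<times> X" using A by (simp add: endo_obj_def)
  have "rpow X R N \<subseteq> X \<times> X" using R by (induction N) auto
  then have X: "x \<in> X" "y \<in> X" using xy by auto
  have xx: "(x, x) \<in> rpow X R N" using canonical_rpow_refl[OF A can per N] X by auto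
  have rec: "X = recurrent_set (X, R)" using can by (simp add: canonical_def)
  have "x \<in> scc (X, R) x" "y \<in> scc (X, R) x"
    using X xx xy yx N rec[symmetric] by (auto simp: scc_def connected_by_def)
  then show "x = y"
    using canonical_rpow_single_valued_on_scc[OF A can] X xx xy by blast
qed

section \<open>Extracting a bijection from a pair of relations\<close>

lemma splitting_of_orders_bijection:
  assumes S: "S \<subseteq> X \<times> X'" and T: "T \<subseteq> X' \<times> X"
    and E: "Id_on X \<subseteq> E" "antisym E" and E': "Id_on X' \<subseteq> E'" "antisym E'"
    and ST: "S O T = E" and TS: "T O S = E'" and ES: "E O S = S" and SE': "S O E' = S"
  defines "F \<equiv> S \<inter> T\<inverse>"
  shows "F O F\<inverse> = Id_on X" "F\<inverse> O F = Id_on X'" "E O F = S" "F O E' = S"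
proof -
  \<comment> \<open>The pair \<open>(x, x)\<close> of \<open>E = S O T\<close> factors through some
    \<open>x'\<close>, which is then a partner of \<open>x\<close> under \<open>F\<close>.\<close>
  have total: "\<exists>x'. (x, x') \<in> F" if "x \<in> X" for x
    using that E(1) ST by (auto simp: F_def)
  have onto: "\<exists>x. (x, x') \<in> F" if "x' \<in> X'" for x'
    using that E'(1) TS by (auto simp: F_def)
  \<comment> \<open>Going through \<open>z\<close> puts both \<open>(x, y)\<close> and
    \<open>(y, x)\<close> in \<open>S O T = E\<close>.\<close>
  have inj: "x = y" if "(x, z) \<in> F" "(y, z) \<in> F" for x y z
    using that E(2) ST by (auto simp: F_def intro: antisymD)
  have fn: "y = z" if "(x, y) \<in> F" "(x, z) \<in> F" for x y z
    using that E'(2) TS by (auto simp: F_def intro: antisymD)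
  have FX: "F \<subseteq> X \<times> X'" using S by (auto simp: F_def)
  show "F O F\<inverse> = Id_on X" using total inj FX by (auto simp: Id_on_iff) blast
  show "F\<inverse> O F = Id_on X'" using onto fn FX by (auto simp: Id_on_iff) blast
  show "E O F = S"
  proof
    show "E O F \<subseteq> S" using ES by (auto simp: F_def)
    show "S \<subseteq> E O F"
    proof clarify
      fix x y' assume xy: "(x, y') \<in> S"
      \<comment> \<open>Since \<open>(y', y)\<close> lies in \<open>T\<close>, going through
        \<open>y'\<close> puts \<open>(x, y)\<close> in \<open>S O T = E\<close>.\<close>
      then obtain y where "(y, y') \<in> F" using onto S by blast
      then show "(x, y') \<in> E O F" using xy ST by (auto simp: F_def)
    qed
  qed
  show "F O E' = S"
  proof
    show "F O E' \<subseteq> S" using SE' by (auto simp: F_def)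
    show "S \<subseteq> F O E'"
    proof clarify
      fix x y' assume xy: "(x, y') \<in> S"
      then obtain x' where "(x, x') \<in> F" using total S by blast
      then show "(x, y') \<in> F O E'" using xy TS by (auto simp: F_def)
    qed
  qed
qed

text \<open>Multiplying \<open>comm\<close> by \<open>F\<inverse>\<close> on both sides shows that
  \<open>F\<inverse>\<close> is a morphism as well.\<close>

lemma endo_isomorphicI:
  assumes R: "R \<subseteq> X \<times> X" and R': "R' \<subseteq> X' \<times> X'" and F: "F \<subseteq> X \<times> X'"
    and FF: "F O F\<inverse> = Id_on X" "F\<inverse> O F = Id_on X'" and comm: "R O F = F O R'"
  shows "endo_isomorphic (X, R) (X', R')"
proof -
  have "R' O F\<inverse> = (Id_on X' O R') O F\<inverse>" using R' by auto
  also have "\<dots> = F\<inverse> O (F O R') O F\<inverse>" by (simp only: FF(2)[symmetric] O_assoc)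
  also have "\<dots> = F\<inverse> O R O Id_on X" by (simp only: comm[symmetric] FF(1)[symmetric] O_assoc)
  also have "\<dots> = F\<inverse> O R" using R by auto
  finally have "F\<inverse> \<in> endo_hom (X', R') (X, R)" using F by (auto simp: endo_hom_def)
  moreover have "F \<in> endo_hom (X, R) (X', R')" using F comm by (auto simp: endo_hom_def)
  ultimately show ?thesis using FF unfolding endo_isomorphic_def fst_conv by blast
qed

section \<open>Representatives of isomorphisms in Szym(FRel)\<close>

lemma szym_class_eqD:
  assumes A: "endo_obj A" and U: "U \<in> endo_hom A A"
    and eq: "szym_class A A U m = szym_id A"
  obtains k where "rpow (fst A) (snd A) k O U = rpow (fst A) (snd A) (m + k)"
proof -
  have sub: "snd A \<subseteq> fst A \<times> fst A" using A by (simp add: endo_obj_def)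
  have Id: "Id_on (fst A) \<in> endo_hom A A" using sub by (auto simp: endo_hom_def)
  have "((U, m), (Id_on (fst A), 0)) \<in> szym_equiv A A"
    using eq_equiv_class[OF _ equiv_szym_equiv[OF A]] eq U Id
    unfolding szym_class_def szym_id_def by (metis SigmaI UNIV_I)
  then obtain k where
    "rpow (fst A) (snd A) k O U = rpow (fst A) (snd A) (m + k) O rpow (fst A) (snd A) 0"
    by (auto simp: szym_equiv_def)
  then show thesis using that rpow_add[OF sub, of "m + k" 0] by simp
qed

text \<open>The same \<open>m\<close> serves both identities: it is the sum of the exponents of the
  two representatives, whichever is applied first.\<close>

lemma szym_isomorphicE:
  assumes A: "endo_obj A" and B: "endo_obj B" and iso: "szym_isomorphic A B"
  obtains S T m k k' where "S \<in> endo_hom A B" "T \<in> endo_hom B A"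
    "rpow (fst A) (snd A) k O S O T = rpow (fst A) (snd A) (m + k)"
    "rpow (fst B) (snd B) k' O T O S = rpow (fst B) (snd B) (m + k')"
proof -
  obtain f g where f: "f \<in> szym_hom A B" and g: "g \<in> szym_hom B A"
    and gf: "szym_comp A A g f = szym_id A" and fg: "szym_comp B B f g = szym_id B"
    using iso by (auto simp: szym_isomorphic_def)
  obtain S m where S: "S \<in> endo_hom A B" and f': "f = szym_class A B S m"
    using f by (auto simp: szym_hom_def szym_class_def elim: quotientE)
  obtain T n where T: "T \<in> endo_hom B A" and g': "g = szym_class B A T n"
    using g by (auto simp: szym_hom_def szym_class_def elim: quotientE)
  obtain k where "rpow (fst A) (snd A) k O (S O T) = rpow (fst A) (snd A) ((m + n) + k)"
    using szym_class_eqD[OF A endo_hom_comp[OF S T]] gf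
    unfolding f' g' szym_comp_class[OF A B S T] by metis
  moreover obtain k' where "rpow (fst B) (snd B) k' O (T O S) = rpow (fst B) (snd B) ((n + m) + k')"
    using szym_class_eqD[OF B endo_hom_comp[OF T S]] fg
    unfolding f' g' szym_comp_class[OF B A T S] by metis
  ultimately show thesis using that[OF S T] by (metis add.commute)
qed

text \<open>Multiplying by a further power lets the unrelated \<open>k\<close> and \<open>k'\<close>
  of the two composites be raised to one common exponent.\<close>

lemma rpow_comp_shift:
  assumes R: "R \<subseteq> X \<times> X" and U: "rpow X R k O U = rpow X R (m + k)"
  shows "rpow X R (k + l) O U = rpow X R (k + l + m)"
proof -
  have "rpow X R (k + l) O U = rpow X R l O rpow X R k O U"
    by (simp add: O_assoc[symmetric] rpow_add[OF R] add_ac)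
  also have "\<dots> = rpow X R (k + l + m)" by (simp add: U rpow_add[OF R] add_ac)
  finally show ?thesis .
qed

lemma endo_hom_rpow_comp:
  assumes A: "endo_obj A" and S: "S \<in> endo_hom A B"
  shows "rpow (fst A) (snd A) n O S \<in> endo_hom A B"
proof -
  let ?r = "rpow (fst A) (snd A)"
  have sub: "snd A \<subseteq> fst A \<times> fst A" using A by (simp add: endo_obj_def)
  have one: "?r 1 = snd A" using sub by auto
  have "?r n \<subseteq> fst A \<times> fst A" using sub by (induction n) auto
  moreover have "?r n O snd A = snd A O ?r n"
    using rpow_add[OF sub, of n 1] rpow_add[OF sub, of 1 n] by (simp only: one add.commute)
  ultimately have "?r n \<in> endo_hom A A" by (simp add: endo_hom_def)
  then show ?thesis using endo_hom_comp S by blast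
qed

section \<open>The two implications\<close>

lemma endo_isomorphic_imp_szym_isomorphic:
  assumes A: "endo_obj A" and B: "endo_obj B" and iso: "endo_isomorphic A B"
  shows "szym_isomorphic A B"
proof -
  obtain S T where S: "S \<in> endo_hom A B" and T: "T \<in> endo_hom B A"
    and "S O T = Id_on (fst A)" "T O S = Id_on (fst B)"
    using iso by (auto simp: endo_isomorphic_def)
  \<comment> \<open>Sending \<open>S\<close> to the class of \<open>(S, 0)\<close> preserves
    composition and identities, hence isomorphisms.\<close>
  then have "szym_comp A A (szym_class B A T 0) (szym_class A B S 0) = szym_id A"
    "szym_comp B B (szym_class A B S 0) (szym_class B A T 0) = szym_id B"
    by (simp_all add: szym_comp_class[OF A B S T] szym_comp_class[OF B A T S] szym_id_def)
  moreover have "szym_class A B S 0 \<in> szym_hom A B" "szym_class B A T 0 \<in> szym_hom B A"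
    using S T by (auto simp: szym_hom_def szym_class_def intro: quotientI)
  ultimately show ?thesis unfolding szym_isomorphic_def by blast
qed

lemma canonical_szym_isomorphic_imp_endo_isomorphic:
  assumes A: "endo_obj (X, R)" and B: "endo_obj (X', R')"
    and cA: "canonical (X, R)" and cB: "canonical (X', R')"
    and iso: "szym_isomorphic (X, R) (X', R')"
  shows "endo_isomorphic (X, R) (X', R')"
proof -
  let ?r = "rpow X R" and ?r' = "rpow X' R'"
  have R: "R \<subseteq> X \<times> X" and R': "R' \<subseteq> X' \<times> X'" using A B by (auto simp: endo_obj_def)
  obtain p where p: "p \<ge> 1" "\<forall>n \<ge> 1. ?r (n + p) = ?r n"
    using cA by (auto simp: canonical_def eventual_period_def)
  obtain p' where p': "p' \<ge> 1" "\<forall>n \<ge> 1. ?r' (n + p') = ?r' n"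
    using cB by (auto simp: canonical_def eventual_period_def)
  obtain S T m k k' where S: "S \<in> endo_hom (X, R) (X', R')" and T: "T \<in> endo_hom (X', R') (X, R)"
    and ST: "?r k O S O T = ?r (m + k)" and TS: "?r' k' O T O S = ?r' (m + k')"
    using szym_isomorphicE[OF A B iso] by (metis fst_conv snd_conv)
  \<comment> \<open>A common multiple of \<open>p\<close> and \<open>p'\<close>, large enough that
    \<open>N - m - 1\<close> is not truncated and \<open>Suc j\<close> bounds \<open>k\<close> and
    \<open>k'\<close>.\<close>
  define N where "N = (m + k + k' + 2) * (p * p')"
  have "p * p' \<ge> 1" using p(1) p'(1) by simp
  then have "(m + k + k' + 2) * 1 \<le> N" unfolding N_def by (rule mult_le_mono2)
  then have N: "N \<ge> m + k + k' + 2" by simp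
  then have N1: "N \<ge> 1" by simp
  have per: "\<forall>n \<ge> 1. ?r (n + N) = ?r n"
    using rpow_periodic_mult[OF p(2), of _ "(m + k + k' + 2) * p'"]
    unfolding N_def by (metis mult.assoc mult.commute)
  have per': "\<forall>n \<ge> 1. ?r' (n + N) = ?r' n"
    using rpow_periodic_mult[OF p'(2), of _ "(m + k + k' + 2) * p"]
    unfolding N_def by (metis mult.assoc mult.commute)
  define j where "j = N - m - 1"
  have j: "Suc j + m = N" "k \<le> Suc j" "k' \<le> Suc j" using N by (auto simp: j_def)
  have one: "?r 1 = R" "?r' 1 = R'" using R R' by auto
  \<comment> \<open>The padding has total exponent \<open>1 + j\<close>, and \<open>T\<close> after
    \<open>S\<close> adds \<open>m\<close>, which gives exactly \<open>N\<close>. One factor goes to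
    \<open>S1\<close> because periodicity starts at exponent 1, so that \<open>S1\<close> absorbs
    \<open>?r N\<close>.\<close>
  define S1 where "S1 = ?r 1 O S"
  define T1 where "T1 = ?r' j O T"
  have hS1: "S1 \<in> endo_hom (X, R) (X', R')" and hT1: "T1 \<in> endo_hom (X', R') (X, R)"
    unfolding S1_def T1_def using endo_hom_rpow_comp[OF A S] endo_hom_rpow_comp[OF B T]
    by (metis fst_conv snd_conv)+
  have cS: "?r n O S = S O ?r' n" for n using endo_hom_rpow[OF S] by simp
  have cT: "?r' n O T = T O ?r n" for n using endo_hom_rpow[OF T] by simp
  have "S1 O T1 = ?r 1 O (S O ?r' j) O T" by (simp only: S1_def T1_def O_assoc)
  also have "\<dots> = ?r (1 + j) O S O T" by (simp only: cS[symmetric] O_assoc[symmetric] rpow_add[OF R])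
  also have "\<dots> = ?r N"
    using rpow_comp_shift[OF R ST, of "Suc j - k"] j by (simp del: rpow.simps)
  finally have ST1: "S1 O T1 = ?r N" .
  have "T1 O S1 = ?r' j O (T O ?r 1) O S" by (simp only: S1_def T1_def O_assoc)
  also have "\<dots> = ?r' (j + 1) O T O S" by (simp only: cT[symmetric] O_assoc[symmetric] rpow_add[OF R'])
  also have "\<dots> = ?r' N"
    using rpow_comp_shift[OF R' TS, of "Suc j - k'"] j by (simp del: rpow.simps)
  finally have TS1: "T1 O S1 = ?r' N" .
  have ES: "?r N O S1 = S1"
    using per by (simp only: S1_def O_assoc[symmetric] rpow_add[OF R] add.commute)
  have SE: "S1 O ?r' N = S1" using ES endo_hom_rpow[OF hS1] by simp
  define F where "F = S1 \<inter> T1\<inverse>"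
  have sub: "S1 \<subseteq> X \<times> X'" "T1 \<subseteq> X' \<times> X" using hS1 hT1 by (auto simp: endo_hom_def)
  note F = splitting_of_orders_bijection[OF sub
      canonical_rpow_refl[OF A cA per N1] canonical_rpow_antisym[OF A cA per N1]
      canonical_rpow_refl[OF B cB per' N1] canonical_rpow_antisym[OF B cB per' N1]
      ST1 TS1 ES SE, folded F_def]
  \<comment> \<open>Absorbing \<open>?r N\<close> into \<open>R\<close>, and \<open>?r' N\<close>
    into \<open>R'\<close>, lets \<open>F\<close> replace \<open>S1 = ?r N O F = F O ?r' N\<close>
    in the commutation relation.\<close>
  have "R O ?r N = R"
    using rpow_add[OF R, of 1 N] per by (metis add.commute order_refl one(1))
  then have "R O F = R O S1" by (metis F(3) O_assoc)
  also have "\<dots> = S1 O R'" using hS1 by (simp add: endo_hom_def)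
  also have "\<dots> = F O ?r' N O R'" by (simp only: F(4)[symmetric] O_assoc)
  also have "?r' N O R' = R'"
    using rpow_add[OF R', of N 1] per' by (metis add.commute order_refl one(2))
  finally have "R O F = F O R'" .
  moreover have "F \<subseteq> X \<times> X'" using sub by (auto simp: F_def)
  ultimately show ?thesis using endo_isomorphicI[OF R R' _ F(1,2)] by blast
qed

theorem theorem2p2:
  fixes X :: "'a set" and R :: "('a \<times> 'a) set"
    and X' :: "'b set" and R' :: "('b \<times> 'b) set"
  assumes "endo_obj (X, R)" and "endo_obj (X', R')"
    and "canonical (X, R)" and "canonical (X', R')"
  shows "szym_isomorphic (X, R) (X', R') \<longleftrightarrow> endo_isomorphic (X, R) (X', R')"
  using canonical_szym_isomorphic_imp_endo_isomorphic[OF assms]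
    endo_isomorphic_imp_szym_isomorphic[OF assms(1,2)] by blast

end
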